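(* Let $k$ be a positive integer and let $T_k$ be the (finite) set of all $k$-free rows $(m_1,\ldots,m_k) \in \mathbf{N}_0^k$ with $m_j \le k/j$ for each $j \in \{1,\ldots,k\}$. For $r = (m_1,\ldots,m_k) \in T_k$ and $j \in \{1,\ldots,k\}$ define $$x_j(r) = \begin{cases} \displaystyle e^{-1/j}\,\frac{1}{j^{m_j}\, m_j!} & \text{if } m_j < \lfloor k/j \rfloor, \\[2ex] \displaystyle 1 - e^{-1/j} \sum_{0 \le i < \lfloor k/j \rfloor} \frac{1}{j^i\, i!} & \text{if } m_j = \lfloor k/j \rfloor. \end{cases}$$ Then $$p(\infty,k) = \sum_{r \in T_k} x_1(r)\, x_2(r) \cdots x_k(r).$$
   Context: Here $\mathbf{N}_0 = \{0,1,2,\ldots\}$. For integers $n \ge k \ge 1$, let $i(n,k)$ be the proportion of permutations in the symmetric group $\mathrm{Sym}_n$ that fix (setwise) at least one $k$-element subset of $\{1,\ldots,n\}$. Let $i(\infty,k) = \lim_{n\to\infty} i(n,k)$ (this limit exists for every $k \ge 1$), and let $p(\infty,k) = 1 - i(\infty,k)$. A row is an element $(m_1,\ldots,m_k)$ of $\mathbf{N}_0^k$. The notation $(1^{m_1},2^{m_2},\ldots,k^{m_k})$ denotes the integer partition having exactly $m_j$ parts of size $j$ for each $j$. A subpartition of it is a partition $(1^{a_1},\ldots,k^{a_k})$ with $0 \le a_j \le m_j$ for all $j$, and its size is $\sum_j j a_j$. The row $(m_1,\ldots,m_k)$ is $k$-free if the partition $(1^{m_1},\ldots,k^{m_k})$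 has no subpartition of size $k$. (The set $T_k$ is the set of rows of the table output by the paper's "Derangements Table Algorithm" on input $k$.) *)

theory Defs
  imports Complex_Main "HOL-Library.FuncSet" "HOL-Combinatorics.Permutations"
begin

text \<open>For \<open>n < k\<close> no \<open>k\<close>-set exists and the proportion below is \<open>0\<close>; this does not affect the limit.\<close>

definition fix_prop :: "nat \<Rightarrow> nat \<Rightarrow> real" where
  "fix_prop n k =
     real (card {\<sigma>. \<sigma> permutes {1..n} \<and> (\<exists>A. A \<subseteq> {1..n} \<and> card A = k \<and> \<sigma> ` A = A)})
     / real (card {\<sigma>. \<sigma> permutes {1..n}})"

definition i_inf :: "nat \<Rightarrow> real" where
  "i_inf k = lim (\<lambda>n. fix_prop n k)"

definition p_inf :: "nat \<Rightarrow> real" where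
  "p_inf k = 1 - i_inf k"

text \<open>
  A row \<open>(m\<^sub>1, \<dots>, m\<^sub>k)\<close> is a function that is extensional on \<open>{1..k}\<close>, so distinct functions
  are distinct rows. It also stands for the partition with \<open>m j\<close> parts of size \<open>j\<close>.
\<close>

definition rows :: "nat \<Rightarrow> (nat \<Rightarrow> nat) set" where
  "rows k = {1..k} \<rightarrow>\<^sub>E UNIV"

definition subpartition :: "nat \<Rightarrow> (nat \<Rightarrow> nat) \<Rightarrow> (nat \<Rightarrow> nat) \<Rightarrow> bool" where
  "subpartition k a m \<longleftrightarrow> a \<in> rows k \<and> (\<forall>j\<in>{1..k}. a j \<le> m j)"

definition part_size :: "nat \<Rightarrow> (nat \<Rightarrow> nat) \<Rightarrow> nat" where
  "part_size k a = (\<Sum>j=1..k. j * a j)"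

definition k_free :: "nat \<Rightarrow> (nat \<Rightarrow> nat) \<Rightarrow> bool" where
  "k_free k m \<longleftrightarrow> \<not> (\<exists>a. subpartition k a m \<and> part_size k a = k)"

definition T_rows :: "nat \<Rightarrow> (nat \<Rightarrow> nat) set" where
  "T_rows k = {m \<in> rows k. k_free k m \<and> (\<forall>j\<in>{1..k}. real (m j) \<le> real k / real j)}"

text \<open>On \<open>T_rows k\<close> the second case is exactly \<open>m j = k div j\<close>.\<close>

definition x_factor :: "nat \<Rightarrow> nat \<Rightarrow> (nat \<Rightarrow> nat) \<Rightarrow> real" where
  "x_factor k j m =
     (if m j < k div j
      then exp (- (1 / real j)) * (1 / (real j ^ m j * fact (m j)))
      else 1 - exp (- (1 / real j)) * (\<Sum>i<k div j. 1 / (real j ^ i * fact i)))"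

lemma finite_T_rows: "finite (T_rows k)"
proof (rule finite_subset)
  show "T_rows k \<subseteq> ({1..k} \<rightarrow>\<^sub>E {..k})"
  proof
    fix m assume m: "m \<in> T_rows k"
    have "m j \<le> k" if j: "j \<in> {1..k}" for j
    proof -
      have "real (m j) \<le> real k / real j"
        using m j by (simp add: T_rows_def)
      also have "\<dots> \<le> real k"
        using j by (simp add: divide_le_eq mult_le_cancel_left1)
      finally show ?thesis by simp
    qed
    then show "m \<in> {1..k} \<rightarrow>\<^sub>E {..k}"
      using m by (auto simp: T_rows_def rows_def PiE_iff)
  qed
qed (simp add: finite_PiE)

end

theory Submission
  imports Defs "HOL-Combinatorics.Orbits" "HOL-Complex_Analysis.Laurent_Convergence"
begin

text \<open>
  A permutation maps a set \<open>A\<close> onto itself exactly when \<open>A\<close> is a union of its cycles. So whether it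
  fixes a \<open>k\<close>-set depends only on the numbers \<open>c\<^sub>1, \<dots>, c\<^sub>k\<close> of its cycles of length \<open>1, \<dots>, k\<close>: it
  fixes none iff the row \<open>(c\<^sub>1, \<dots>, c\<^sub>k)\<close> is \<open>k\<close>-free (\<open>fixes_set_iff_not_k_free\<close>). For a random
  permutation of \<open>n\<close> points these numbers become independent Poisson variables with means \<open>1/j\<close> as
  \<open>n\<close> grows. A part of size \<open>j\<close> can be used at most \<open>k div j\<close> times in a partition of \<open>k\<close>, so
  being \<open>k\<close>-free depends only on the numbers \<open>min c\<^sub>j (k div j)\<close>, and \<open>x_factor k j r\<close> is the
  probability that the \<open>j\<close>-th truncated Poisson variable takes the value \<open>r j\<close>. Summing the product
  of these probabilities over \<open>T_rows k\<close> gives the claim.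

  The Poisson limit comes from an exact count (\<open>count_permutations_of_type\<close>): among the \<open>n!\<close>
  permutations, the proportion with prescribed \<open>c\<^sub>j = m\<^sub>j\<close> for \<open>j \<le> k\<close> is
  \<open>q (n - s) * (\<Prod>j\<le>k. 1 / (j ^ m\<^sub>j * m\<^sub>j!))\<close>, where \<open>s \<le> n\<close> is the size of the row and \<open>q N\<close> is the
  \<open>N\<close>-th coefficient of \<open>exp (- (\<Sum>j\<le>k. z ^ j / j)) / (1 - z)\<close>, that is, the proportion of
  permutations of \<open>N\<close> points without cycles of length at most \<open>k\<close>. The count goes by induction on the
  number of points: a permutation of \<open>n + 1\<close> points arises in exactly one way from a permutation
  \<open>\<sigma>\<close> of \<open>n\<close> points by composing it with the transposition of the new point \<open>a\<close> and some point
  \<open>b\<close>, which puts \<open>a\<close> into the cycle of \<open>b\<close> (or makes it a fixed point if \<open>b = a\<close>). The resulting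
  recurrence is the one satisfied by \<open>q\<close>. Moreover \<open>q N\<close> is a partial sum, evaluated at the point
  \<open>1\<close>, of the Taylor series of the entire function \<open>exp (- (\<Sum>j\<le>k. z ^ j / j))\<close>, so it tends to
  \<open>exp (- (\<Sum>j\<le>k. 1 / j))\<close>.

  The convergence just described is for single rows, while infinitely many rows are \<open>k\<close>-free. Since
  the limiting masses add up to \<open>1\<close>, no mass escapes to infinity, and large finite boxes of rows
  approximate the probability of being \<open>k\<close>-free for all large \<open>n\<close> at once (\<open>tendsto_by_exhaustion\<close>).
\<close>

section \<open>Cycle types and the insertion of a point\<close>

definition cycle_type :: "('a \<Rightarrow> 'a) \<Rightarrow> 'a set \<Rightarrow> nat \<Rightarrow> nat" where
  "cycle_type \<sigma> S j = card {C \<in> orbit \<sigma> ` S. card C = j}"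

lemma permutes_self_in_orbit:
  assumes "finite S" "\<sigma> permutes S"
  shows "x \<in> orbit \<sigma> x"
  by (rule permutation_self_in_orbit) (use assms in \<open>auto simp: permutation_permutes\<close>)

lemma orbit_eq_if_mem:
  assumes "finite S" "\<sigma> permutes S" "y \<in> orbit \<sigma> x"
  shows "orbit \<sigma> y = orbit \<sigma> x"
  using assms(3) orbit_swap[OF permutes_self_in_orbit[OF assms(1,2)] assms(3)]
  by (blast intro: orbit_trans)

lemma disjnt_orbits:
  assumes "finite S" "\<sigma> permutes S" "C \<in> orbit \<sigma> ` S" "D \<in> orbit \<sigma> ` S" "C \<noteq> D"
  shows "C \<inter> D = {}"
proof (rule ccontr)
  assume "C \<inter> D \<noteq> {}"
  then obtain y where "y \<in> C" "y \<in> D" by blast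
  then have "orbit \<sigma> y = C" "orbit \<sigma> y = D"
    using assms(3,4) orbit_eq_if_mem[OF assms(1,2)] by auto
  with assms(5) show False by simp
qed

lemma orbit_image_subset:
  assumes "\<sigma> permutes S" "C \<in> orbit \<sigma> ` S"
  shows "C \<subseteq> S"
  using assms(2) permutes_orbit_subset[OF assms(1)] by auto

lemma cycle_type_0:
  assumes "finite S" "\<sigma> permutes S"
  shows "cycle_type \<sigma> S 0 = 0"
proof -
  have "card C \<noteq> 0" if "C \<in> orbit \<sigma> ` S" for C
  proof -
    have "finite C"
      using orbit_image_subset[OF assms(2) that] assms(1) by (rule finite_subset)
    moreover have "C \<noteq> {}"
      using that orbit_nonempty[of \<sigma>] by blast
    ultimately show ?thesis by simp
  qed
  then have "{C \<in> orbit \<sigma> ` S. card C = 0} = {}"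
    by blast
  then show ?thesis
    by (simp only: cycle_type_def card.empty)
qed

text \<open>
  The product \<open>\<tau>\<close> sends \<open>a\<close> to \<open>b\<close> and sends the old preimage of \<open>b\<close> to \<open>a\<close>, and
  it agrees with \<open>\<sigma>\<close> elsewhere. Thus \<open>a\<close> is spliced into the cycle of \<open>b\<close> just before \<open>b\<close>.
\<close>

lemma orbits_insert_new_point:
  assumes fin: "finite S" and perm: "\<sigma> permutes S" and a: "a \<notin> S" and b: "b \<in> S"
  defines "\<tau> \<equiv> Transposition.transpose a b \<circ> \<sigma>"
  shows "orbit \<tau> ` insert a S = insert (insert a (orbit \<sigma> b)) (orbit \<sigma> ` S - {orbit \<sigma> b})"
proof -
  let ?O = "orbit \<sigma> b"
  have \<sigma>a: "\<sigma> a = a"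
    using perm a by (simp add: permutes_not_in)
  have \<sigma>S: "\<sigma> x \<in> S \<longleftrightarrow> x \<in> S" for x
    using perm by (simp add: permutes_in_image)
  have \<tau>a: "\<tau> a = b"
    by (simp add: \<tau>_def \<sigma>a)
  have \<tau>b: "\<tau> x = a" if "\<sigma> x = b" for x
    using that by (simp add: \<tau>_def)
  have \<tau>eq: "\<tau> x = \<sigma> x" if "x \<in> S" "\<sigma> x \<noteq> b" for x
    using that a \<sigma>S[of x] by (auto simp: \<tau>_def Transposition.transpose_def)
  have bO: "b \<in> ?O"
    by (rule permutes_self_in_orbit[OF fin perm])
  have OS: "?O \<subseteq> S"
    using perm b by (rule permutes_orbit_subset)
  have \<tau>perm: "\<tau> permutes insert a S"
    unfolding \<tau>_def using perm b
    by (intro permutes_compose[OF permutes_subset[OF perm]] permutes_swap_id) auto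
  have fin': "finite (insert a S)"
    using fin by simp
  have new: "orbit \<tau> a = insert a ?O"
  proof
    show "orbit \<tau> a \<subseteq> insert a ?O"
    proof
      fix y assume "y \<in> orbit \<tau> a"
      then show "y \<in> insert a ?O"
      proof induction
        case base
        then show ?case using bO \<tau>a by simp
      next
        case (step y)
        then show ?case
          using bO \<tau>a \<tau>b[of y] \<tau>eq[of y] OS orbit.step[of y \<sigma> b]
          by (cases "\<sigma> y = b"; cases "y = a") auto
      qed
    qed
    have "y \<in> orbit \<tau> a" if "y \<in> ?O" for y
      using that
    proof induction
      case base
      have "b \<in> orbit \<tau> a"
        using orbit.base[of \<tau> a] \<tau>a by simp
      then show ?case
        using \<tau>eq[of b] b orbit.step[of b \<tau> a] by (cases "\<sigma> b = b") auto
    next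
      case (step y)
      then show ?case
        using \<tau>eq[of y] OS orbit.step[of y \<tau> a] orbit.base[of \<tau> a] \<tau>a
        by (cases "\<sigma> y = b") auto
    qed
    then show "insert a ?O \<subseteq> orbit \<tau> a"
      using permutes_self_in_orbit[OF fin' \<tau>perm, of a] by blast
  qed
  have same: "orbit \<tau> x = orbit \<sigma> x" if x: "x \<in> S - ?O" for x
  proof (rule orbit_cong0)
    show "x \<in> S - ?O" by (rule x)
    have avoid: "\<sigma> y \<notin> ?O" if "y \<notin> ?O" for y
      using that orbit_eq_if_mem[OF fin perm, of "\<sigma> y" b]
        orbit_eq_if_mem[OF fin perm orbit.base, of y] permutes_self_in_orbit[OF fin perm, of y]
      by metis
    show eq: "\<tau> y = \<sigma> y" if "y \<in> S - ?O" for y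
      using that \<tau>eq[of y] avoid[of y] bO by auto
    show "\<tau> \<in> S - ?O \<rightarrow> S - ?O"
      using eq avoid \<sigma>S by auto
  qed
  have "orbit \<tau> y = insert a ?O" if "y \<in> ?O" for y
    using orbit_eq_if_mem[OF fin' \<tau>perm, of y a] new that by simp
  then have "orbit \<tau> ` ?O = {insert a ?O}"
    using bO by blast
  moreover have "orbit \<tau> ` (S - ?O) = orbit \<sigma> ` S - {?O}"
  proof -
    have "orbit \<tau> ` (S - ?O) = orbit \<sigma> ` (S - ?O)"
      using same by (rule image_cong[OF refl])
    also have "\<dots> = orbit \<sigma> ` S - {?O}"
      using orbit_eq_if_mem[OF fin perm, of _ b] permutes_self_in_orbit[OF fin perm] by blast
    finally show ?thesis .
  qed
  moreover have "insert a S = insert a (?O \<union> (S - ?O))"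
    using OS by auto
  ultimately show ?thesis
    using new by (metis image_Un image_insert insert_absorb2 insert_is_Un)
qed

text \<open>
  The length, before insertion, of the cycle that receives \<open>a\<close>. The choice \<open>b = a\<close> creates the fixed
  point \<open>a\<close>; counting this as joining a cycle of length \<open>0\<close> avoids a separate case in the recurrence.
\<close>

definition host_size :: "('a \<Rightarrow> 'a) \<Rightarrow> 'a \<Rightarrow> 'a \<Rightarrow> nat" where
  "host_size \<sigma> a b = (if b = a then 0 else card (orbit \<sigma> b))"

text \<open>
  One cycle of length \<open>h\<close> turns into one of length \<open>h + 1\<close>. For \<open>h = 0\<close> the truncated subtraction
  does nothing, because there are no cycles of length \<open>0\<close>.
\<close>

lemma cycle_type_insert_point:
  assumes fin: "finite S" and perm: "\<sigma> permutes S" and a: "a \<notin> S" and b: "b \<in> insert a S"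
  defines "h \<equiv> host_size \<sigma> a b"
  shows "cycle_type (Transposition.transpose a b \<circ> \<sigma>) (insert a S) j =
    cycle_type \<sigma> S j - of_bool (j = h) + of_bool (j = Suc h)"
proof (cases "b = a")
  case True
  have "\<sigma> a = a"
    using perm a by (simp add: permutes_not_in)
  then have "orbit \<sigma> a = {a}"
    by (simp add: orbit_eq_singleton_iff)
  moreover have "{a} \<notin> orbit \<sigma> ` S"
    using orbit_image_subset[OF perm] a by auto
  moreover have "{C \<in> insert {a} X. card C = j} =
      (if j = 1 then insert {a} {C \<in> X. card C = j} else {C \<in> X. card C = j})" for X
    by auto
  ultimately have "cycle_type \<sigma> (insert a S) j = cycle_type \<sigma> S j + of_bool (j = 1)"
    using fin by (auto simp: cycle_type_def)
  then show ?thesis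
    using True cycle_type_0[OF fin perm] by (cases "j = 0") (auto simp: h_def host_size_def)
next
  case False
  with b have bS: "b \<in> S" by simp
  let ?O = "orbit \<sigma> b"
  let ?X = "{C \<in> orbit \<sigma> ` S. card C = j}"
  have OS: "?O \<subseteq> S" "finite ?O"
    using perm bS fin by (auto intro: finite_subset dest: permutes_orbit_subset)
  have h: "h = card ?O"
    using False by (simp add: h_def host_size_def)
  have new: "card (insert a ?O) = Suc h" "insert a ?O \<notin> orbit \<sigma> ` S"
    using OS a orbit_image_subset[OF perm, of "insert a ?O"] card_insert_disjoint[of ?O a]
    unfolding h by blast+
  have "cycle_type (Transposition.transpose a b \<circ> \<sigma>) (insert a S) j =
      card {C \<in> insert (insert a ?O) (orbit \<sigma> ` S - {?O}). card C = j}"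
    unfolding cycle_type_def orbits_insert_new_point[OF fin perm a bS] ..
  also have "{C \<in> insert (insert a ?O) (orbit \<sigma> ` S - {?O}). card C = j} =
      (if j = Suc h then insert (insert a ?O) (?X - {?O}) else ?X - {?O})"
    using new by auto
  also have "card \<dots> = card (?X - {?O}) + of_bool (j = Suc h)"
    using new fin by auto
  also have "card (?X - {?O}) = card ?X - of_bool (j = h)"
    using h bS fin by (auto simp: card_Diff_singleton_if)
  finally show ?thesis
    by (simp only: cycle_type_def)
qed

text \<open>
  The number of ways to insert a new point into a cycle of length \<open>l\<close>, with the convention for
  \<open>l = 0\<close> that there is one way to start a new cycle.
\<close>

definition slots :: "(nat \<Rightarrow> nat) \<Rightarrow> nat \<Rightarrow> nat" where
  "slots c l = (if l = 0 then 1 else l * c l)"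

lemma card_Union_by_size:
  assumes "finite \<C>" "\<And>C. C \<in> \<C> \<Longrightarrow> finite C" "\<And>C. C \<in> \<C> \<Longrightarrow> card C \<in> J" "finite J"
    and "\<And>C D. C \<in> \<C> \<Longrightarrow> D \<in> \<C> \<Longrightarrow> C \<noteq> D \<Longrightarrow> C \<inter> D = {}"
  shows "card (\<Union>\<C>) = (\<Sum>j\<in>J. j * card {C \<in> \<C>. card C = j})"
proof -
  have "card (\<Union>\<C>) = (\<Sum>C\<in>\<C>. card C)"
    using assms by (intro card_Union_disjoint) (auto simp: pairwise_def disjnt_def)
  also have "\<dots> = (\<Sum>j\<in>J. \<Sum>C\<in>{C \<in> \<C>. card C = j}. card C)"
    using assms by (intro sum.group[symmetric]) auto
  also have "\<dots> = (\<Sum>j\<in>J. j * card {C \<in> \<C>. card C = j})"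
    by (intro sum.cong) auto
  finally show ?thesis .
qed

lemma card_host_size:
  assumes fin: "finite S" and perm: "\<sigma> permutes S" and a: "a \<notin> S"
  shows "card {b \<in> insert a S. host_size \<sigma> a b = l} = slots (cycle_type \<sigma> S) l"
proof (cases "l = 0")
  case True
  have "card (orbit \<sigma> b) = 0 \<Longrightarrow> False" if "b \<in> S" for b
    using cycle_type_0[OF fin perm] that fin by (auto simp: cycle_type_def)
  then have "{b \<in> insert a S. host_size \<sigma> a b = l} = {a}"
    using True by (auto simp: host_size_def split: if_splits)
  then show ?thesis
    using True by (simp add: slots_def)
next
  case False
  let ?X = "{C \<in> orbit \<sigma> ` S. card C = l}"
  have "{b \<in> insert a S. host_size \<sigma> a b = l} = \<Union>?X"
  proof (intro set_eqI iffI)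
    fix b assume "b \<in> {b \<in> insert a S. host_size \<sigma> a b = l}"
    then have "b \<in> S" "card (orbit \<sigma> b) = l"
      using False by (auto simp: host_size_def split: if_splits)
    then show "b \<in> \<Union>?X"
      using permutes_self_in_orbit[OF fin perm, of b] by auto
  next
    fix b assume "b \<in> \<Union>?X"
    then obtain x where x: "x \<in> S" "b \<in> orbit \<sigma> x" "card (orbit \<sigma> x) = l" by auto
    then have "b \<in> S" "orbit \<sigma> b = orbit \<sigma> x"
      using orbit_eq_if_mem[OF fin perm] permutes_orbit_subset[OF perm] by blast+
    then show "b \<in> {b \<in> insert a S. host_size \<sigma> a b = l}"
      using x a by (auto simp: host_size_def)
  qed
  also have "card \<dots> = (\<Sum>j\<in>{l}. j * card {C \<in> ?X. card C = j})"
  proof (rule card_Union_by_size)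
    show "finite C" if "C \<in> ?X" for C
      using that orbit_image_subset[OF perm] fin by (blast intro: finite_subset)
    show "C \<inter> D = {}" if "C \<in> ?X" "D \<in> ?X" "C \<noteq> D" for C D
      using that disjnt_orbits[OF fin perm] by blast
  qed (use fin in auto)
  finally show ?thesis
    using False by (simp add: slots_def cycle_type_def)
qed

section \<open>Counting the permutations with given short cycles\<close>

definition agrees_upto :: "nat \<Rightarrow> (nat \<Rightarrow> nat) \<Rightarrow> (nat \<Rightarrow> nat) \<Rightarrow> bool" where
  "agrees_upto k c m \<longleftrightarrow> (\<forall>j\<in>{1..k}. c j = m j)"

definition row_weight :: "nat \<Rightarrow> (nat \<Rightarrow> nat) \<Rightarrow> real" where
  "row_weight k m = (\<Prod>j=1..k. 1 / (real j ^ m j * fact (m j)))"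

text \<open>The coefficients of \<open>z ^ s * Q z\<close>, if \<open>q\<close> lists the coefficients of \<open>Q z\<close>.\<close>

definition shifted :: "(nat \<Rightarrow> real) \<Rightarrow> nat \<Rightarrow> nat \<Rightarrow> real" where
  "shifted q s n = (if s \<le> n then q (n - s) else 0)"

abbreviation add_part :: "nat \<Rightarrow> (nat \<Rightarrow> nat) \<Rightarrow> nat \<Rightarrow> nat" where
  "add_part l m \<equiv> m(l := Suc (m l))"

text \<open>
  This is the identity that makes the product formula compatible with insertion: the factor \<open>l * m l\<close>
  that counts insertions cancels against \<open>l ^ m l * (m l)!\<close>. For \<open>l = 0\<close> nothing changes,
  as the product starts at \<open>1\<close>.
\<close>

lemma row_weight_add_part:
  assumes "l \<le> k"
  shows "real (slots (add_part l m) l) * row_weight k (add_part l m) = row_weight k m"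
proof (cases "l = 0")
  case True
  then show ?thesis
    by (auto simp: slots_def row_weight_def intro!: prod.cong)
next
  case False
  with assms have l: "l \<in> {1..k}" by simp
  let ?f = "\<lambda>m j. 1 / (real j ^ m j * fact (m j))"
  let ?rest = "\<lambda>m. \<Prod>j\<in>{1..k} - {l}. ?f m j"
  have split: "row_weight k m' = ?f m' l * ?rest m'" for m'
    unfolding row_weight_def using l by (intro prod.remove) auto
  have "real (slots (add_part l m) l) * row_weight k (add_part l m) =
      (real (slots (add_part l m) l) * ?f (add_part l m) l) * ?rest (add_part l m)"
    by (simp only: split mult.assoc)
  also have "real (slots (add_part l m) l) * ?f (add_part l m) l = ?f m l"
    using False by (simp add: slots_def field_simps del: of_nat_Suc) (simp add: algebra_simps)
  also have "?rest (add_part l m) = ?rest m"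
    by (intro prod.cong) auto
  finally show ?thesis
    by (simp only: split)
qed

lemma part_size_add_part:
  assumes "l \<le> k"
  shows "part_size k (add_part l m) = part_size k m + l"
proof (cases "l = 0")
  case True
  then show ?thesis
    by (auto simp: part_size_def intro!: sum.cong)
next
  case False
  with assms have l: "l \<in> {1..k}" by simp
  have "(\<Sum>j\<in>{1..k} - {l}. j * add_part l m j) = (\<Sum>j\<in>{1..k} - {l}. j * m j)"
    by (intro sum.cong) auto
  moreover have "part_size k m' = l * m' l + (\<Sum>j\<in>{1..k} - {l}. j * m' j)" for m'
    unfolding part_size_def using l by (intro sum.remove) auto
  ultimately show ?thesis
    by simp
qed

text \<open>
  Reading indices below \<open>0\<close> as coefficients \<open>0\<close> keeps the recurrence valid on both sides of \<open>s\<close>; at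
  \<open>n + 1 = s\<close> the factor on the left vanishes.
\<close>

lemma shifted_recurrence:
  assumes rec: "\<And>N. real (Suc N) * q (Suc N) = real N * q N + (if k \<le> N then q (N - k) else 0)"
  shows "(real n + 1 - real s) * shifted q s (Suc n) =
    (real n - real s) * shifted q s n + shifted q (s + k) n"
proof (cases "s \<le> n")
  case True
  then have "real (Suc (n - s)) = real n + 1 - real s" "real (n - s) = real n - real s"
    "shifted q s (Suc n) = q (Suc (n - s))" "shifted q s n = q (n - s)"
    "shifted q (s + k) n = (if k \<le> n - s then q (n - s - k) else 0)"
    by (auto simp: shifted_def Suc_diff_le)
  then show ?thesis
    using rec[of "n - s"] by (simp add: algebra_simps)
next
  case False
  then show ?thesis
    by (cases "s = Suc n") (auto simp: shifted_def)
qed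

lemma sum_slots:
  assumes "agrees_upto k c m"
  shows "(\<Sum>l\<le>k. slots c l) = Suc (part_size k m)"
proof -
  have "{..k} = insert 0 {1..k}" by auto
  then show ?thesis
    using assms by (auto simp: slots_def part_size_def agrees_upto_def intro!: sum.cong)
qed

text \<open>
  If the new point joins a cycle of length \<open>l \<le> k\<close> and the result has row \<open>m\<close>, then the old row was
  \<open>pre l\<close>: one cycle of length \<open>l + 1\<close> fewer and, unless \<open>l = 0\<close>, one of length \<open>l\<close> more. This is possible only
  if \<open>m\<close> has a part \<open>l + 1\<close>, except for \<open>l = k\<close>, where the longer cycle is not recorded in the row.
  Points that join a cycle longer than \<open>k\<close> do not change the row; they give the first summand.
\<close>

lemma count_insertions_of_type:
  fixes m :: "nat \<Rightarrow> nat"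
  assumes fin: "finite S" and perm: "\<sigma> permutes S" and a: "a \<notin> S"
  defines "c \<equiv> cycle_type \<sigma> S"
  defines "pre \<equiv> \<lambda>l. add_part l (m(Suc l := m (Suc l) - 1))"
  shows "(\<Sum>b\<in>insert a S. of_bool (agrees_upto k
      (cycle_type (Transposition.transpose a b \<circ> \<sigma>) (insert a S)) m)) =
    (real (card S) - real (part_size k m)) * of_bool (agrees_upto k c m) +
    (\<Sum>l\<le>k. of_bool (l < k \<longrightarrow> m (Suc l) > 0) * real (slots (pre l) l) *
      of_bool (agrees_upto k c (pre l)))"
proof -
  let ?B = "insert a S" and ?h = "host_size \<sigma> a"
  define P where "P h \<longleftrightarrow> agrees_upto k (\<lambda>j. c j - of_bool (j = h) + of_bool (j = Suc h)) m" for h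
  let ?A = "of_bool (agrees_upto k c m) :: real"
  have "(\<Sum>b\<in>?B. of_bool (agrees_upto k
      (cycle_type (Transposition.transpose a b \<circ> \<sigma>) ?B) m)) = (\<Sum>b\<in>?B. of_bool (P (?h b)) :: real)"
  proof (rule sum.cong[OF refl])
    fix b assume b: "b \<in> ?B"
    have "cycle_type (Transposition.transpose a b \<circ> \<sigma>) ?B =
        (\<lambda>j. c j - of_bool (j = ?h b) + of_bool (j = Suc (?h b)))"
      unfolding c_def using cycle_type_insert_point[OF fin perm a b] by blast
    then show "of_bool (agrees_upto k (cycle_type (Transposition.transpose a b \<circ> \<sigma>) ?B) m) =
        (of_bool (P (?h b)) :: real)"
      by (simp add: P_def)
  qed
  \<comment> \<open>Compare every insertion with one into a long cycle, so that only \<open>l \<le> k\<close> needs correction.\<close>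
  also have "\<dots> = (\<Sum>b\<in>?B. ?A + (\<Sum>l\<le>k. of_bool (?h b = l) * (of_bool (P l) - ?A)))"
  proof (rule sum.cong[OF refl])
    fix b assume "b \<in> ?B"
    have "P (?h b) \<longleftrightarrow> agrees_upto k c m" if "?h b > k"
      using that by (auto simp: P_def agrees_upto_def)
    then show "of_bool (P (?h b)) = ?A + (\<Sum>l\<le>k. of_bool (?h b = l) * (of_bool (P l) - ?A))"
      by (cases "?h b \<le> k") (auto simp: of_bool_def if_distrib[of "\<lambda>x. x * _"] cong: if_cong)
  qed
  also have "\<dots> = (real (card S) + 1) * ?A +
      (\<Sum>l\<le>k. (\<Sum>b\<in>?B. of_bool (?h b = l)) * (of_bool (P l) - ?A))"
    using fin a by (simp only: sum.distrib sum.swap[of _ "{..k}"] sum_distrib_right) simp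
  also have "\<dots> = (real (card S) + 1) * ?A + (\<Sum>l\<le>k. real (slots c l) * (of_bool (P l) - ?A))"
  proof -
    have "(\<Sum>b\<in>?B. of_bool (?h b = l)) = real (slots c l)" for l
      using fin card_host_size[OF fin perm a, of l] by (simp add: c_def Int_def)
    then show ?thesis by simp
  qed
  also have "\<dots> = (real (card S) + 1) * ?A - (\<Sum>l\<le>k. real (slots c l)) * ?A +
      (\<Sum>l\<le>k. real (slots c l) * of_bool (P l))"
    by (simp add: algebra_simps sum_subtractf sum_distrib_left)
  also have "(real (card S) + 1) * ?A - (\<Sum>l\<le>k. real (slots c l)) * ?A =
      (real (card S) - real (part_size k m)) * ?A"
  proof (cases "agrees_upto k c m")
    case True
    have "(\<Sum>l\<le>k. real (slots c l)) = 1 + real (part_size k m)"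
      using sum_slots[OF True] by (simp flip: of_nat_sum)
    then show ?thesis by simp
  qed simp
  also have "(\<Sum>l\<le>k. real (slots c l) * of_bool (P l)) =
    (\<Sum>l\<le>k. of_bool (l < k \<longrightarrow> m (Suc l) > 0) * real (slots (pre l) l) *
      of_bool (agrees_upto k c (pre l)))"
  proof (rule sum.cong[OF refl])
    fix l assume l: "l \<in> {..k}"
    show "real (slots c l) * of_bool (P l) =
      of_bool (l < k \<longrightarrow> m (Suc l) > 0) * real (slots (pre l) l) * of_bool (agrees_upto k c (pre l))"
    proof (cases "slots c l = 0")
      case True
      then have "l \<in> {1..k}" "c l = 0"
        using l by (auto simp: slots_def split: if_splits)
      then have "\<not> agrees_upto k c (pre l)"
        by (auto simp: agrees_upto_def pre_def intro!: bexI[of _ l])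
      then show ?thesis using True by simp
    next
      case False
      then have pos: "l = 0 \<or> c l > 0"
        by (auto simp: slots_def split: if_splits)
      have "P l \<longleftrightarrow> (l < k \<longrightarrow> m (Suc l) > 0) \<and> agrees_upto k c (pre l)"
      proof
        assume P: "P l"
        have "m (Suc l) > 0" if "l < k"
          using P that by (auto simp: P_def agrees_upto_def dest!: bspec[of _ _ "Suc l"])
        moreover have "agrees_upto k c (pre l)"
          unfolding agrees_upto_def
        proof
          fix j assume "j \<in> {1..k}"
          then have "m j = c j - of_bool (j = l) + of_bool (j = Suc l)" "j \<noteq> 0"
            using P by (auto simp: P_def agrees_upto_def)
          then show "c j = pre l j"
            using pos by (auto simp: pre_def)
        qed
        ultimately show "(l < k \<longrightarrow> m (Suc l) > 0) \<and> agrees_upto k c (pre l)" by blast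
      next
        assume R: "(l < k \<longrightarrow> m (Suc l) > 0) \<and> agrees_upto k c (pre l)"
        show "P l"
          unfolding P_def agrees_upto_def
        proof
          fix j assume j: "j \<in> {1..k}"
          then have "c j = pre l j" "j = Suc l \<Longrightarrow> m j > 0"
            using R by (auto simp: agrees_upto_def)
          then show "c j - of_bool (j = l) + of_bool (j = Suc l) = m j"
            by (auto simp: pre_def split: if_splits)
        qed
      qed
      moreover have "slots c l = slots (pre l) l" if "agrees_upto k c (pre l)"
        using that l by (auto simp: slots_def agrees_upto_def)
      ultimately show ?thesis by auto
    qed
  qed
  finally show ?thesis .
qed

text \<open>
  After the induction hypothesis is applied, the insertions into cycles of length \<open>l < k\<close> contribute
  \<open>(l + 1) * m (l + 1)\<close> copies of the same term, so together they contribute \<open>part_size k m\<close> copies.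
  The length \<open>l = k\<close> and the long cycles supply the other two terms of the recurrence for \<open>q\<close>.
\<close>

lemma count_permutations_of_type:
  fixes q :: "nat \<Rightarrow> real"
  assumes q0: "q 0 = 1"
    and rec: "\<And>N. real (Suc N) * q (Suc N) = real N * q N + (if k \<le> N then q (N - k) else 0)"
    and fin: "finite S"
  shows "(\<Sum>\<sigma> | \<sigma> permutes S. of_bool (agrees_upto k (cycle_type \<sigma> S) m)) =
    fact (card S) * row_weight k m * shifted q (part_size k m) (card S)"
  using fin
proof (induction S arbitrary: m rule: finite_induct)
  case empty
  have "agrees_upto k (cycle_type \<sigma> {}) m \<longleftrightarrow> (\<forall>j\<in>{1..k}. m j = 0)"
    for \<sigma> :: "'a \<Rightarrow> 'a"
    by (auto simp: agrees_upto_def cycle_type_def)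
  moreover have "part_size k m = 0 \<longleftrightarrow> (\<forall>j\<in>{1..k}. m j = 0)"
    by (auto simp: part_size_def)
  moreover have "row_weight k m = 1" if "\<forall>j\<in>{1..k}. m j = 0"
    using that by (simp add: row_weight_def)
  ultimately show ?case
    by (auto simp: shifted_def q0)
next
  case (insert a S m)
  let ?n = "card S" and ?s = "part_size k m" and ?w = "row_weight k m"
  let ?perms = "{\<sigma>. \<sigma> permutes S}"
  let ?A = "\<lambda>\<sigma> m. of_bool (agrees_upto k (cycle_type \<sigma> S) m) :: real"
  let ?base = "\<lambda>l. m(Suc l := m (Suc l) - 1)"
  let ?pre = "\<lambda>l. add_part l (?base l)"
  let ?ok = "\<lambda>l. of_bool (l < k \<longrightarrow> m (Suc l) > 0) :: real"
  let ?term = "\<lambda>l. ?ok l * real (slots (?pre l) l) * (row_weight k (?pre l) *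
      shifted q (part_size k (?pre l)) ?n)"
  have "(\<Sum>\<sigma> | \<sigma> permutes insert a S. of_bool (agrees_upto k (cycle_type \<sigma> (insert a S)) m)) =
      (\<Sum>\<sigma>\<in>?perms. \<Sum>b\<in>insert a S. of_bool (agrees_upto k
        (cycle_type (Transposition.transpose a b \<circ> \<sigma>) (insert a S)) m) :: real)"
    by (subst sum_over_permutations_insert[OF insert.hyps]) (rule sum.swap)
  also have "\<dots> = (\<Sum>\<sigma>\<in>?perms. (real ?n - real ?s) * ?A \<sigma> m +
      (\<Sum>l\<le>k. ?ok l * real (slots (?pre l) l) * ?A \<sigma> (?pre l)))"
    using insert.hyps by (intro sum.cong[OF refl] count_insertions_of_type) auto
  also have "\<dots> = (real ?n - real ?s) * (\<Sum>\<sigma>\<in>?perms. ?A \<sigma> m) +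
      (\<Sum>l\<le>k. ?ok l * real (slots (?pre l) l) * (\<Sum>\<sigma>\<in>?perms. ?A \<sigma> (?pre l)))"
    by (simp only: sum.distrib sum.swap[of _ "{..k}"] sum_distrib_left)
  also have "\<dots> = fact ?n * ((real ?n - real ?s) * ?w * shifted q ?s ?n + (\<Sum>l\<le>k. ?term l))"
    unfolding insert.IH by (simp only: distrib_left sum_distrib_left mult_ac)
  also have "(\<Sum>l\<le>k. ?term l) = (\<Sum>l<k. ?term l) + ?term k"
    by (simp add: lessThan_Suc_atMost[symmetric])
  also have "?term k = ?w * shifted q (?s + k) ?n"
  proof -
    \<comment> \<open>\<open>?base k\<close> changes only the coordinate \<open>k + 1\<close>, which lies outside the row.\<close>
    have "row_weight k (?base k) = ?w" "part_size k (?base k) = ?s"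
      by (auto simp: row_weight_def part_size_def intro!: prod.cong sum.cong)
    then show ?thesis
      using row_weight_add_part[of k k "?base k"] part_size_add_part[of k k "?base k"]
      by (simp add: mult.assoc[symmetric] del: fun_upd_apply)
  qed
  also have "(\<Sum>l<k. ?term l) = (\<Sum>l<k. real (Suc l * m (Suc l)) * (?w * shifted q ?s (Suc ?n)))"
  proof (rule sum.cong[OF refl])
    fix l assume "l \<in> {..<k}"
    then have l: "l \<le> k" "Suc l \<le> k" "l < k" by auto
    show "?term l = real (Suc l * m (Suc l)) * (?w * shifted q ?s (Suc ?n))"
    proof (cases "m (Suc l) = 0")
      case True
      then show ?thesis using l by simp
    next
      case False
      \<comment> \<open>Both \<open>?pre l\<close> and \<open>m\<close> arise from \<open>?base l\<close> by adding one part, of size \<open>l\<close> and \<open>l + 1\<close>.\<close>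
      then have m: "add_part (Suc l) (?base l) = m" by auto
      have "real (slots (?pre l) l) * row_weight k (?pre l) = row_weight k (?base l)"
        by (rule row_weight_add_part[OF l(1)])
      also have "\<dots> = real (Suc l * m (Suc l)) * ?w"
        using row_weight_add_part[OF l(2), of "?base l"] unfolding m by (simp add: slots_def)
      finally have w: "real (slots (?pre l) l) * row_weight k (?pre l) =
          real (Suc l * m (Suc l)) * ?w" .
      have "?s = Suc (part_size k (?pre l))"
        using part_size_add_part[OF l(2), of "?base l"] part_size_add_part[OF l(1), of "?base l"]
        unfolding m by linarith
      then have "shifted q ?s (Suc ?n) = shifted q (part_size k (?pre l)) ?n"
        by (simp add: shifted_def)
      then show ?thesis
        using False w by (simp only: mult.assoc[symmetric]) simp
    qed
  qed
  also have "\<dots> = real ?s * (?w * shifted q ?s (Suc ?n))"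
  proof -
    have "(\<Sum>l<k. Suc l * m (Suc l)) = ?s"
      unfolding part_size_def by (rule sum.reindex_bij_witness[of _ "\<lambda>j. j - 1" Suc]) auto
    then show ?thesis
      by (simp only: sum_distrib_right[symmetric] of_nat_sum[symmetric])
  qed
  also have "fact ?n * ((real ?n - real ?s) * ?w * shifted q ?s ?n +
      (real ?s * (?w * shifted q ?s (Suc ?n)) + ?w * shifted q (?s + k) ?n)) =
      fact ?n * ?w * ((real ?n - real ?s) * shifted q ?s ?n + shifted q (?s + k) ?n +
        real ?s * shifted q ?s (Suc ?n))"
    by (simp add: algebra_simps)
  also have "\<dots> = fact ?n * ?w * ((real ?n + 1) * shifted q ?s (Suc ?n))"
    using shifted_recurrence[OF rec, of ?n ?s] by (intro arg_cong[of _ _ "(*) _"]) argo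
  finally have "(\<Sum>\<sigma> | \<sigma> permutes insert a S. of_bool (agrees_upto k (cycle_type \<sigma> (insert a S)) m)) =
      fact ?n * ?w * ((real ?n + 1) * shifted q ?s (Suc ?n))" .
  moreover have "card (insert a S) = Suc ?n" "fact (Suc ?n) = (real ?n + 1) * fact ?n"
    using insert.hyps by (auto simp: algebra_simps)
  ultimately show ?case
    by (simp only: mult_ac)
qed

section \<open>The proportion of permutations without short cycles\<close>

text \<open>
  Let \<open>f z = exp (- (\<Sum>j\<le>k. z ^ j / j))\<close> have Taylor coefficients \<open>a n\<close>, and let \<open>q\<close> be their partial
  sums, so that \<open>q\<close> has generating function \<open>f z / (1 - z)\<close>. The equation
  \<open>f' z = - (\<Sum>j<k. z ^ j) * f z\<close> expresses \<open>(N + 1) * a (N + 1)\<close> as minus the sum of the last \<open>k\<close>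
  coefficients up to \<open>N\<close>, which is \<open>q (N - k) - q N\<close>; this is the recurrence. As \<open>f\<close> is entire, its
  Taylor series converges at \<open>1\<close>, which gives the limit.
\<close>

lemma derangement_sequence:
  fixes k :: nat
  obtains q :: "nat \<Rightarrow> real" where
    "q 0 = 1"
    "\<And>N. real (Suc N) * q (Suc N) = real N * q N + (if k \<le> N then q (N - k) else 0)"
    "q \<longlonglongrightarrow> exp (- (\<Sum>j=1..k. 1 / real j))"
proof -
  define f :: "complex \<Rightarrow> complex" where "f = (\<lambda>z. exp (- (\<Sum>j=1..k. z ^ j / of_nat j)))"
  define F where "F = fps_expansion f 0"
  define a where "a = (\<lambda>n. Re (fps_nth F n))"
  define q where "q = (\<lambda>N. \<Sum>n\<le>N. a n)"
  have holo: "f holomorphic_on A" for A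
    unfolding f_def by (intro holomorphic_intros) auto
  have F: "f has_fps_expansion F"
    unfolding F_def using holo by (intro has_fps_expansion_fps_expansion[of UNIV]) auto
  have "deriv f z = - (\<Sum>j<k. z ^ j) * f z" for z
  proof -
    have "(\<Sum>j=1..k. of_nat j * z ^ (j - 1) / of_nat j) = (\<Sum>j<k. z ^ j)"
      by (rule sum.reindex_bij_witness[of _ Suc "\<lambda>j. j - 1"]) auto
    moreover have "(f has_field_derivative
        (- (\<Sum>j=1..k. of_nat j * z ^ (j - 1) / of_nat j)) * f z) (at z)"
      unfolding f_def by (auto intro!: derivative_eq_intros simp: sum_distrib_left mult_ac)
    ultimately show ?thesis
      by (simp add: DERIV_imp_deriv)
  qed
  then have "deriv f = (\<lambda>z. - (\<Sum>j<k. z ^ j) * f z)"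
    by blast
  moreover have "deriv f has_fps_expansion fps_deriv F"
    using F by (rule has_fps_expansion_deriv)
  moreover have "(\<lambda>z. - (\<Sum>j<k. z ^ j) * f z) has_fps_expansion - (\<Sum>j<k. fps_X ^ j) * F"
    by (intro fps_expansion_intros F)
  ultimately have ode: "fps_deriv F = - (\<Sum>j<k. fps_X ^ j) * F"
    by (metis fps_expansion_unique_complex)
  have a_rec: "real (Suc N) * a (Suc N) = - (\<Sum>j<k. if N < j then 0 else a (N - j))" for N
  proof -
    have "of_nat (Suc N) * fps_nth F (Suc N) = fps_nth (fps_deriv F) N"
      by simp
    also have "\<dots> = - (\<Sum>j<k. if N < j then 0 else fps_nth F (N - j))"
      unfolding ode
      by (simp add: sum_distrib_right fps_sum_nth fps_X_power_mult_nth)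
    finally have "Re (of_nat (Suc N) * fps_nth F (Suc N)) =
        Re (- (\<Sum>j<k. if N < j then 0 else fps_nth F (N - j)))"
      by (rule arg_cong)
    then show ?thesis
      by (simp add: a_def if_distrib[of Re] cong: if_cong)
  qed
  show thesis
  proof
    have "f 0 = 1"
      by (simp add: f_def power_0_left)
    then show "q 0 = 1"
      using has_fps_expansion_imp_0_eq_fps_nth_0[OF F] by (simp add: q_def a_def)
    show "real (Suc N) * q (Suc N) = real N * q N + (if k \<le> N then q (N - k) else 0)" for N
    proof -
      have window: "(\<Sum>j<k. if N < j then 0 else a (N - j)) = q N - (if k \<le> N then q (N - k) else 0)"
      proof -
        have "(\<Sum>j<k. if N < j then 0 else a (N - j)) = (\<Sum>j\<in>{j. j < k \<and> j \<le> N}. a (N - j))"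
          by (rule sum.mono_neutral_cong_right) auto
        also have "\<dots> = (\<Sum>i\<in>{i. i \<le> N \<and> N < i + k}. a i)"
          by (rule sum.reindex_bij_witness[of _ "\<lambda>i. N - i" "\<lambda>j. N - j"]) auto
        also have "\<dots> = q N - (if k \<le> N then q (N - k) else 0)"
        proof (cases "k \<le> N")
          case True
          then have "{..N} = {i. i \<le> N \<and> N < i + k} \<union> {..N - k}"
            by auto
          then have "q N = sum a ({i. i \<le> N \<and> N < i + k} \<union> {..N - k})"
            by (simp only: q_def)
          also have "\<dots> = (\<Sum>i\<in>{i. i \<le> N \<and> N < i + k}. a i) + q (N - k)"
            unfolding q_def using True by (intro sum.union_disjoint) auto
          finally show ?thesis using True by simp
        next
          case False
          then have "{i. i \<le> N \<and> N < i + k} = {..N}"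
            by auto
          then show ?thesis using False by (simp add: q_def)
        qed
        finally show ?thesis .
      qed
      have "q (Suc N) = q N + a (Suc N)"
        by (simp add: q_def)
      then have "real (Suc N) * q (Suc N) = real (Suc N) * q N + real (Suc N) * a (Suc N)"
        by (simp add: algebra_simps)
      then show ?thesis
        unfolding a_rec window by (simp add: algebra_simps)
    qed
    have "(\<lambda>n. fps_nth F n * 1 ^ n) sums f 1"
      by (rule has_fps_expansion_imp_sums_complex[OF F holo, of 1 "ereal 2"]) auto
    then have "a sums Re (f 1)"
      using sums_Re by (fastforce simp: a_def)
    moreover have "Re (f 1) = exp (- (\<Sum>j=1..k. 1 / real j))"
    proof -
      have "f 1 = of_real (exp (- (\<Sum>j=1..k. 1 / real j)))"
        by (simp add: f_def flip: exp_of_real)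
      then show ?thesis by simp
    qed
    ultimately show "q \<longlonglongrightarrow> exp (- (\<Sum>j=1..k. 1 / real j))"
      by (simp add: sums_def_le q_def)
  qed
qed

section \<open>Invariant sets\<close>

text \<open>
  An invariant set contains the whole orbit of each of its points, so the orbits inside it form a
  subpartition of its size. Conversely, choosing \<open>a j\<close> of the cycles of length \<open>j\<close> for each \<open>j\<close> and
  taking their union realises any subpartition \<open>a\<close>.
\<close>

lemma fixes_set_iff_not_k_free:
  assumes fin: "finite S" and perm: "\<sigma> permutes S"
  shows "(\<exists>A. A \<subseteq> S \<and> card A = k \<and> \<sigma> ` A = A) \<longleftrightarrow>
    \<not> k_free k (restrict (cycle_type \<sigma> S) {1..k})"
proof
  assume "\<exists>A. A \<subseteq> S \<and> card A = k \<and> \<sigma> ` A = A"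
  then obtain A where A: "A \<subseteq> S" "card A = k" "\<sigma> ` A = A" by blast
  let ?\<C> = "{C \<in> orbit \<sigma> ` S. C \<subseteq> A}"
  let ?a = "restrict (\<lambda>j. card {C \<in> ?\<C>. card C = j}) {1..k}"
  have finA: "finite A"
    using A fin by (blast intro: finite_subset)
  have orb: "orbit \<sigma> x \<subseteq> A" if "x \<in> A" for x
  proof
    fix y assume "y \<in> orbit \<sigma> x"
    then show "y \<in> A"
      by induction (use that A in auto)
  qed
  have "A = \<Union>?\<C>"
    using orb permutes_self_in_orbit[OF fin perm] A by blast
  also have "card (\<Union>?\<C>) = (\<Sum>j\<in>{1..k}. j * card {C \<in> ?\<C>. card C = j})"
  proof (rule card_Union_by_size)
    show "C \<inter> D = {}" if "C \<in> ?\<C>" "D \<in> ?\<C>" "C \<noteq> D" for C D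
      using that disjnt_orbits[OF fin perm] by blast
    show "finite C" if "C \<in> ?\<C>" for C
      using that finA finite_subset by blast
    show "card C \<in> {1..k}" if "C \<in> ?\<C>" for C
    proof -
      have "C \<subseteq> A" "C \<noteq> {}"
        using that orbit_nonempty[of \<sigma>] by (blast, metis (lifting) imageE mem_Collect_eq)
      then show ?thesis
        using finA A card_mono[of A C] by (auto simp: Suc_le_eq card_gt_0_iff intro: finite_subset)
    qed
  qed (use fin in auto)
  finally have "part_size k ?a = k"
    using A by (simp add: part_size_def)
  moreover have "subpartition k ?a (restrict (cycle_type \<sigma> S) {1..k})"
    using fin by (auto simp: subpartition_def Defs.rows_def cycle_type_def intro!: card_mono)
  ultimately show "\<not> k_free k (restrict (cycle_type \<sigma> S) {1..k})"
    by (auto simp: k_free_def)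
next
  assume "\<not> k_free k (restrict (cycle_type \<sigma> S) {1..k})"
  then obtain a where "subpartition k a (restrict (cycle_type \<sigma> S) {1..k})"
    and size: "part_size k a = k"
    unfolding k_free_def by blast
  then have a: "a j \<le> cycle_type \<sigma> S j" if "j \<in> {1..k}" for j
    using that by (simp add: subpartition_def)
  have "\<exists>D. D \<subseteq> {C \<in> orbit \<sigma> ` S. card C = j} \<and> card D = a j" if "j \<in> {1..k}" for j
    using a[OF that, unfolded cycle_type_def] by (rule obtain_subset_with_card_n) blast
  then obtain \<D> where \<D>:
    "\<And>j. j \<in> {1..k} \<Longrightarrow> \<D> j \<subseteq> {C \<in> orbit \<sigma> ` S. card C = j} \<and> card (\<D> j) = a j"
    by metis
  have size_\<D>: "card C = j" if "j \<in> {1..k}" "C \<in> \<D> j" for C j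
    using \<D>[OF that(1)] that(2) by blast
  let ?\<C> = "\<Union>j\<in>{1..k}. \<D> j"
  have sub: "?\<C> \<subseteq> orbit \<sigma> ` S"
    using \<D> by blast
  have "card (\<Union>?\<C>) = (\<Sum>j\<in>{1..k}. j * card {C \<in> ?\<C>. card C = j})"
  proof (rule card_Union_by_size)
    show "C \<inter> D = {}" if "C \<in> ?\<C>" "D \<in> ?\<C>" "C \<noteq> D" for C D
      using that by (rule disjnt_orbits[OF fin perm subsetD[OF sub] subsetD[OF sub]])
    show "finite ?\<C>"
      using sub fin finite_subset by blast
    show "finite C" if "C \<in> ?\<C>" for C
      using that sub orbit_image_subset[OF perm, of C] fin finite_subset by blast
    show "card C \<in> {1..k}" if "C \<in> ?\<C>" for C
      using that size_\<D> by auto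
  qed auto
  also have "\<dots> = part_size k a"
  proof -
    have "{C \<in> ?\<C>. card C = j} = \<D> j" if "j \<in> {1..k}" for j
      using that size_\<D> by blast
    then show ?thesis
      using \<D> by (auto simp: part_size_def intro!: sum.cong)
  qed
  finally have "card (\<Union>?\<C>) = k"
    using size by simp
  moreover have US: "\<Union>?\<C> \<subseteq> S"
    using orbit_image_subset[OF perm subsetD[OF sub]] by (rule Union_least)
  moreover have "\<sigma> ` \<Union>?\<C> = \<Union>?\<C>"
  proof (rule endo_inj_surj)
    show "finite (\<Union>?\<C>)"
      using US fin by (rule finite_subset)
    show "\<sigma> ` \<Union>?\<C> \<subseteq> \<Union>?\<C>"
    proof
      fix y assume "y \<in> \<sigma> ` \<Union>?\<C>"
      then obtain x C where x: "y = \<sigma> x" "x \<in> C" "C \<in> ?\<C>" by blast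
      then obtain z where "C = orbit \<sigma> z"
        using sub by blast
      then have "y \<in> C"
        using x(1,2) by (simp add: orbit.step)
      then show "y \<in> \<Union>?\<C>"
        using x(3) by (rule UnionI[rotated])
    qed
    show "inj_on \<sigma> (\<Union>?\<C>)"
      using permutes_inj[OF perm] by (rule inj_on_subset) simp
  qed
  ultimately show "\<exists>A. A \<subseteq> S \<and> card A = k \<and> \<sigma> ` A = A"
    by (intro exI conjI)
qed

section \<open>The Poisson limit of the row of short cycles\<close>

definition poisson_mass :: "nat \<Rightarrow> nat \<Rightarrow> real" where
  "poisson_mass j i = exp (- (1 / real j)) * (1 / (real j ^ i * fact i))"

definition row_of :: "nat \<Rightarrow> nat \<Rightarrow> (nat \<Rightarrow> nat) \<Rightarrow> nat \<Rightarrow> nat" where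
  "row_of k n \<sigma> = restrict (cycle_type \<sigma> {1..n}) {1..k}"

definition row_prob :: "nat \<Rightarrow> nat \<Rightarrow> (nat \<Rightarrow> nat) set \<Rightarrow> real" where
  "row_prob k n A = (\<Sum>\<sigma> | \<sigma> permutes {1..n}. of_bool (row_of k n \<sigma> \<in> A)) / fact n"

lemma row_prob_singleton_tendsto:
  assumes m: "m \<in> Defs.rows k"
  shows "(\<lambda>n. row_prob k n {m}) \<longlonglongrightarrow> (\<Prod>j=1..k. poisson_mass j (m j))"
proof -
  obtain q :: "nat \<Rightarrow> real" where q: "q 0 = 1"
    "\<And>N. real (Suc N) * q (Suc N) = real N * q N + (if k \<le> N then q (N - k) else 0)"
    and lim: "q \<longlonglongrightarrow> exp (- (\<Sum>j=1..k. 1 / real j))"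
    by (rule derangement_sequence[of k]) (rule that)
  let ?s = "part_size k m"
  have "row_of k n \<sigma> = m \<longleftrightarrow> agrees_upto k (cycle_type \<sigma> {1..n}) m" for n \<sigma>
    using m by (auto simp: row_of_def agrees_upto_def Defs.rows_def fun_eq_iff PiE_iff extensional_def)
  then have "row_prob k n {m} = row_weight k m * shifted q ?s n" for n
    using count_permutations_of_type[OF q, of "{1..n}" m] by (simp add: row_prob_def)
  moreover have "(\<lambda>n. row_weight k m * shifted q ?s n) \<longlonglongrightarrow>
      row_weight k m * exp (- (\<Sum>j=1..k. 1 / real j))"
  proof (intro tendsto_intros)
    have "(\<lambda>n. q (n - ?s)) \<longlonglongrightarrow> exp (- (\<Sum>j=1..k. 1 / real j))"
      by (rule filterlim_compose[OF lim filterlim_minus_const_nat_at_top])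
    moreover have "\<forall>\<^sub>F n in sequentially. q (n - ?s) = shifted q ?s n"
      using eventually_ge_at_top[of ?s] by eventually_elim (simp add: shifted_def)
    ultimately show "shifted q ?s \<longlonglongrightarrow> exp (- (\<Sum>j=1..k. 1 / real j))"
      by (rule Lim_transform_eventually)
  qed
  moreover have "row_weight k m * exp (- (\<Sum>j=1..k. 1 / real j)) = (\<Prod>j=1..k. poisson_mass j (m j))"
  proof -
    have "exp (- (\<Sum>j=1..k. 1 / real j)) = (\<Prod>j=1..k. exp (- (1 / real j)))"
      by (simp add: exp_sum flip: sum_negf)
    then show ?thesis
      by (simp only: row_weight_def poisson_mass_def prod.distrib mult.commute)
  qed
  ultimately show ?thesis
    by simp
qed

lemma row_prob_finite_tendsto:
  assumes "finite A" "A \<subseteq> Defs.rows k"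
  shows "(\<lambda>n. row_prob k n A) \<longlonglongrightarrow> (\<Sum>m\<in>A. \<Prod>j=1..k. poisson_mass j (m j))"
proof -
  have "row_prob k n A = (\<Sum>m\<in>A. row_prob k n {m})" for n
  proof -
    have "of_bool (x \<in> A) = (\<Sum>m\<in>A. of_bool (x = m) :: real)" for x
      using assms(1) by (simp add: of_bool_def)
    then show ?thesis
      by (simp only: row_prob_def sum_divide_distrib[symmetric] sum.swap[of _ A] singleton_iff)
  qed
  moreover have "(\<lambda>n. \<Sum>m\<in>A. row_prob k n {m}) \<longlonglongrightarrow> (\<Sum>m\<in>A. \<Prod>j=1..k. poisson_mass j (m j))"
    using assms(2) by (intro tendsto_sum row_prob_singleton_tendsto) auto
  ultimately show ?thesis
    by simp
qed

lemma row_prob_UNIV: "row_prob k n UNIV = 1"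
  by (simp add: row_prob_def card_permutations[OF refl])

lemma row_prob_mono: "A \<subseteq> B \<Longrightarrow> row_prob k n A \<le> row_prob k n B"
  unfolding row_prob_def by (intro divide_right_mono sum_mono) (auto simp: of_bool_def)

lemma row_prob_le_Int: "row_prob k n A \<le> row_prob k n (A \<inter> B) + (1 - row_prob k n B)"
proof -
  have "row_prob k n A + row_prob k n B \<le> row_prob k n (A \<inter> B) + row_prob k n UNIV"
    unfolding row_prob_def add_divide_distrib[symmetric] sum.distrib[symmetric]
    by (intro divide_right_mono sum_mono) (auto simp: of_bool_def)
  then show ?thesis
    by (simp add: row_prob_UNIV)
qed

lemma one_minus_fix_prop: "1 - fix_prop n k = row_prob k n {m. k_free k m}"
proof -
  let ?P = "{\<sigma>. \<sigma> permutes {1..n}}"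
  have "fix_prop n k = (\<Sum>\<sigma>\<in>?P. of_bool (\<not> k_free k (row_of k n \<sigma>))) / fact n"
    unfolding fix_prop_def row_of_def
    by (simp add: fixes_set_iff_not_k_free card_permutations[OF refl] finite_permutations
        Collect_conj_eq cong: conj_cong)
  moreover have "(\<Sum>\<sigma>\<in>?P. of_bool (\<not> k_free k (row_of k n \<sigma>))) =
      fact n - (\<Sum>\<sigma>\<in>?P. of_bool (k_free k (row_of k n \<sigma>)) :: real)"
    by (simp only: of_bool_not_iff sum_subtractf) (simp add: card_permutations[OF refl])
  ultimately show ?thesis
    by (simp add: row_prob_def diff_divide_distrib)
qed

lemma poisson_mass_sums: "poisson_mass j sums 1"
proof -
  have "(\<lambda>i. exp (- (1 / real j)) * ((1 / real j) ^ i /\<^sub>R fact i)) sums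
      (exp (- (1 / real j)) * exp (1 / real j))"
    by (intro sums_mult exp_converges)
  moreover have "poisson_mass j = (\<lambda>i. exp (- (1 / real j)) * ((1 / real j) ^ i /\<^sub>R fact i))"
    by (simp add: poisson_mass_def fun_eq_iff field_simps power_one_over)
  ultimately show ?thesis
    by (simp flip: exp_add)
qed

definition box :: "nat \<Rightarrow> nat \<Rightarrow> (nat \<Rightarrow> nat) set" where
  "box k M = {1..k} \<rightarrow>\<^sub>E {..M}"

text \<open>
  The mass of a box is a product of partial sums of Poisson probabilities. That its limit is \<open>1\<close> is what
  rules out an escape of mass to infinity.
\<close>

lemma box_mass_tendsto: "(\<lambda>M. \<Sum>m\<in>box k M. \<Prod>j=1..k. poisson_mass j (m j)) \<longlonglongrightarrow> 1"
proof -
  have "(\<lambda>M. \<Prod>j=1..k. \<Sum>i\<le>M. poisson_mass j i) \<longlonglongrightarrow> (\<Prod>j=1..k. 1)"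
    using poisson_mass_sums by (intro tendsto_prod) (simp add: sums_def_le)
  then show ?thesis
    by (simp add: box_def prod_sum_PiE)
qed

definition truncate_row :: "nat \<Rightarrow> (nat \<Rightarrow> nat) \<Rightarrow> nat \<Rightarrow> nat" where
  "truncate_row k m = restrict (\<lambda>j. min (m j) (k div j)) {1..k}"

text \<open>
  A subpartition of size \<open>k\<close> has at most \<open>k div j\<close> parts of size \<open>j\<close>, so it survives truncation.
\<close>

lemma k_free_truncate_row: "k_free k (truncate_row k m) \<longleftrightarrow> k_free k m"
proof -
  have "subpartition k a (truncate_row k m) \<longleftrightarrow> subpartition k a m" if a: "part_size k a = k" for a
  proof -
    have "a j \<le> k div j" if j: "j \<in> {1..k}" for j
    proof -
      have "j * a j \<le> part_size k a"
        unfolding part_size_def using j by (intro member_le_sum) auto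
      then show ?thesis
        using a j by (simp add: less_eq_div_iff_mult_less_eq mult.commute)
    qed
    then show ?thesis
      by (auto simp: subpartition_def truncate_row_def)
  qed
  then show ?thesis
    by (auto simp: k_free_def)
qed

lemma T_rows_iff:
  "r \<in> T_rows k \<longleftrightarrow> r \<in> Defs.rows k \<and> k_free k r \<and> (\<forall>j\<in>{1..k}. r j \<le> k div j)"
proof -
  have "real x \<le> real k / real j \<longleftrightarrow> x \<le> k div j" if "j \<in> {1..k}" for x j
  proof -
    have "real x \<le> real k / real j \<longleftrightarrow> real (x * j) \<le> real k"
      using that by (simp add: pos_le_divide_eq)
    also have "\<dots> \<longleftrightarrow> x \<le> k div j"
      unfolding of_nat_le_iff using that by (simp add: less_eq_div_iff_mult_less_eq)
    finally show ?thesis .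
  qed
  then show ?thesis
    by (auto simp: T_rows_def)
qed

text \<open>
  The left-hand sums exhaust the probability that a Poisson variable of mean \<open>1/j\<close>, truncated at
  \<open>k div j\<close>, equals \<open>r j\<close>. Below the truncation point only \<open>i = r j\<close> contributes; at the truncation point
  the whole upper tail does, which explains the two cases of \<open>x_factor\<close>.
\<close>

lemma truncated_coordinate_tendsto:
  assumes "r j \<le> k div j"
  shows "(\<lambda>M. \<Sum>i | i \<le> M \<and> min i (k div j) = r j. poisson_mass j i) \<longlonglongrightarrow> x_factor k j r"
proof (cases "r j < k div j")
  case True
  then have single: "{i. i \<le> M \<and> min i (k div j) = r j} = {r j}" if "M \<ge> r j" for M
    using that by auto
  have "\<forall>\<^sub>F M in sequentially. x_factor k j r =
      (\<Sum>i | i \<le> M \<and> min i (k div j) = r j. poisson_mass j i)"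
    using eventually_ge_at_top[of "r j"]
    by eventually_elim (use True in \<open>simp add: single x_factor_def poisson_mass_def\<close>)
  then show ?thesis
    by (rule Lim_transform_eventually[OF tendsto_const])
next
  case False
  let ?d = "k div j"
  have "(\<lambda>M. (\<Sum>i\<le>M. poisson_mass j i) - (\<Sum>i<?d. poisson_mass j i)) \<longlonglongrightarrow>
      1 - (\<Sum>i<?d. poisson_mass j i)"
    using poisson_mass_sums by (intro tendsto_intros) (simp add: sums_def_le)
  moreover have "1 - (\<Sum>i<?d. poisson_mass j i) = x_factor k j r"
    using False by (simp add: x_factor_def poisson_mass_def sum_distrib_left)
  moreover have "\<forall>\<^sub>F M in sequentially. (\<Sum>i\<le>M. poisson_mass j i) - (\<Sum>i<?d. poisson_mass j i) =
      (\<Sum>i | i \<le> M \<and> min i ?d = r j. poisson_mass j i)"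
    using eventually_ge_at_top[of ?d]
  proof eventually_elim
    case (elim M)
    have "{..M} = {..<?d} \<union> {i. i \<le> M \<and> min i ?d = r j}"
      using elim assms False by auto
    moreover have "sum (poisson_mass j) ({..<?d} \<union> {i. i \<le> M \<and> min i ?d = r j}) =
        (\<Sum>i<?d. poisson_mass j i) + (\<Sum>i | i \<le> M \<and> min i ?d = r j. poisson_mass j i)"
      using assms False by (intro sum.union_disjoint) auto
    ultimately show ?case
      by simp
  qed
  ultimately show ?thesis
    by (auto intro: Lim_transform_eventually)
qed

text \<open>
  The \<open>k\<close>-free rows in a box are grouped by their truncations, which are the elements of \<open>T_rows k\<close>.
  Each group is a product of sets, so its mass factors over the coordinates.
\<close>

lemma k_free_box_mass_tendsto:
  "(\<lambda>M. \<Sum>m\<in>{m. k_free k m} \<inter> box k M. \<Prod>j=1..k. poisson_mass j (m j)) \<longlonglongrightarrow>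
    (\<Sum>r\<in>T_rows k. \<Prod>j=1..k. x_factor k j r)"
proof -
  let ?w = "\<lambda>m. \<Prod>j=1..k. poisson_mass j (m j)"
  have "(\<Sum>m\<in>{m. k_free k m} \<inter> box k M. ?w m) =
      (\<Sum>r\<in>T_rows k. \<Prod>j=1..k. \<Sum>i | i \<le> M \<and> min i (k div j) = r j. poisson_mass j i)" for M
  proof -
    let ?S = "{m. k_free k m} \<inter> box k M"
    have "finite (box k M)"
      by (simp add: box_def finite_PiE)
    then have "(\<Sum>m\<in>?S. ?w m) = (\<Sum>r\<in>T_rows k. \<Sum>m | m \<in> ?S \<and> truncate_row k m = r. ?w m)"
      by (intro sum.group[symmetric])
        (auto simp: finite_T_rows T_rows_iff k_free_truncate_row, auto simp: truncate_row_def Defs.rows_def)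
    also have "\<dots> = (\<Sum>r\<in>T_rows k. \<Prod>j=1..k. \<Sum>i | i \<le> M \<and> min i (k div j) = r j. poisson_mass j i)"
    proof (rule sum.cong[OF refl])
      fix r assume r: "r \<in> T_rows k"
      have trunc: "truncate_row k m = r \<longleftrightarrow> (\<forall>j\<in>{1..k}. min (m j) (k div j) = r j)" for m
        using r by (auto simp: T_rows_def Defs.rows_def truncate_row_def fun_eq_iff PiE_iff extensional_def)
      have free: "k_free k m" if "truncate_row k m = r" for m
        using r that k_free_truncate_row[of k m] by (simp add: T_rows_iff)
      have "m \<in> ?S \<and> truncate_row k m = r \<longleftrightarrow>
          m \<in> box k M \<and> (\<forall>j\<in>{1..k}. min (m j) (k div j) = r j)" for m
        using trunc[of m] free[of m] by blast
      then have "{m. m \<in> ?S \<and> truncate_row k m = r} =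
          {m \<in> box k M. \<forall>j\<in>{1..k}. min (m j) (k div j) = r j}"
        by (rule Collect_cong)
      also have "\<dots> = (\<Pi>\<^sub>E j\<in>{1..k}. {i. i \<le> M \<and> min i (k div j) = r j})"
        unfolding box_def PiE_def Pi_def by blast
      finally show "(\<Sum>m | m \<in> ?S \<and> truncate_row k m = r. ?w m) =
          (\<Prod>j=1..k. \<Sum>i | i \<le> M \<and> min i (k div j) = r j. poisson_mass j i)"
        by (simp add: prod_sum_PiE)
    qed
    finally show ?thesis .
  qed
  moreover have "(\<lambda>M. \<Sum>r\<in>T_rows k. \<Prod>j=1..k. \<Sum>i | i \<le> M \<and> min i (k div j) = r j. poisson_mass j i)
      \<longlonglongrightarrow> (\<Sum>r\<in>T_rows k. \<Prod>j=1..k. x_factor k j r)"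
    by (intro tendsto_sum tendsto_prod truncated_coordinate_tendsto) (auto simp: T_rows_iff)
  ultimately show ?thesis
    by simp
qed

text \<open>
  Here \<open>P n\<close> is the probability of an event, \<open>G M n\<close> that of its part in the \<open>M\<close>-th finite set, and
  \<open>F M n\<close> that of the finite set itself. The error \<open>1 - F M n\<close> is small for one suitable \<open>M\<close> and all
  large \<open>n\<close>, so the limits in \<open>n\<close> and in \<open>M\<close> can be exchanged.
\<close>

lemma tendsto_by_exhaustion:
  fixes P :: "nat \<Rightarrow> real" and G F :: "nat \<Rightarrow> nat \<Rightarrow> real"
  assumes lower: "\<And>M n. G M n \<le> P n"
    and upper: "\<And>M n. P n \<le> G M n + (1 - F M n)"
    and G: "\<And>M. G M \<longlonglongrightarrow> g M" and F: "\<And>M. F M \<longlonglongrightarrow> f M"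
    and g: "g \<longlonglongrightarrow> L" and f: "f \<longlonglongrightarrow> 1"
  shows "P \<longlonglongrightarrow> L"
proof (rule tendstoI)
  fix e :: real assume "e > 0"
  then have e: "e / 4 > 0" by simp
  have "\<forall>\<^sub>F M in sequentially. dist (g M) L < e / 4 \<and> dist (f M) 1 < e / 4"
    using tendstoD[OF g e] tendstoD[OF f e] by (rule eventually_conj)
  then obtain M where M: "dist (g M) L < e / 4" "dist (f M) 1 < e / 4"
    by (auto simp: eventually_sequentially)
  show "\<forall>\<^sub>F n in sequentially. dist (P n) L < e"
    using tendstoD[OF G[of M] e] tendstoD[OF F[of M] e]
  proof eventually_elim
    case (elim n)
    then show ?case
      using M lower[of M n] upper[of n M] by (simp add: dist_real_def abs_if split: if_splits)
  qed
qed

theorem lemma3: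
  fixes k :: nat
  assumes "k \<ge> 1"
  shows "convergent (\<lambda>n. fix_prop n k) \<and> p_inf k = (\<Sum>r\<in>T_rows k. \<Prod>j=1..k. x_factor k j r)"
proof -
  let ?L = "\<Sum>r\<in>T_rows k. \<Prod>j=1..k. x_factor k j r"
  let ?K = "{m. k_free k m}"
  have box: "finite (box k M)" "box k M \<subseteq> Defs.rows k" for M
    by (auto simp: box_def Defs.rows_def finite_PiE)
  have "(\<lambda>n. row_prob k n ?K) \<longlonglongrightarrow> ?L"
  proof (rule tendsto_by_exhaustion)
    show "row_prob k n (?K \<inter> box k M) \<le> row_prob k n ?K" for M n
      by (rule row_prob_mono) simp
    show "row_prob k n ?K \<le> row_prob k n (?K \<inter> box k M) + (1 - row_prob k n (box k M))" for M n
      by (rule row_prob_le_Int)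
    show "(\<lambda>n. row_prob k n (?K \<inter> box k M)) \<longlonglongrightarrow>
        (\<Sum>m\<in>?K \<inter> box k M. \<Prod>j=1..k. poisson_mass j (m j))" for M
      using box[of M] by (intro row_prob_finite_tendsto) auto
    show "(\<lambda>n. row_prob k n (box k M)) \<longlonglongrightarrow> (\<Sum>m\<in>box k M. \<Prod>j=1..k. poisson_mass j (m j))" for M
      using box[of M] by (rule row_prob_finite_tendsto)
  qed (rule k_free_box_mass_tendsto box_mass_tendsto)+
  then have "(\<lambda>n. 1 - row_prob k n ?K) \<longlonglongrightarrow> 1 - ?L"
    by (intro tendsto_intros)
  then have lim: "(\<lambda>n. fix_prop n k) \<longlonglongrightarrow> 1 - ?L"
    by (simp flip: one_minus_fix_prop)
  then have "p_inf k = ?L"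
    by (simp add: p_inf_def i_inf_def limI)
  with lim show ?thesis
    by (auto simp: convergent_def)
qed

end
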